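(* There exists a constant $\alpha$ with $0<\alpha<1/c_1$ such that the following holds. Let $\sigma>0$ satisfy $$\sigma<\min\left\{\delta_1,\delta_2,\frac{4\omega(1-\alpha c_1)}{2c_2+Lc_1^2}\right\},$$ set $$\eta:=\alpha c_1+\frac{(2c_2+Lc_1^2)\sigma}{4\omega},\qquad r:=\frac{\sigma(1-\eta)}{2(1+c_1)[1-\eta+(1+\alpha)c_1]},$$ and let $\{x_k\}$ be a sequence generated by the LMM-IP with starting point $x_0\in B(x_*,r)\cap C$. If $\theta_k\in[0,\alpha)$ for every $k\ge0$, then $\{x_k\}$ converges linearly to its limit point $\bar x$. If, additionally, $\lim_{k\to\infty}\theta_k=0$, the convergence is superlinear.
   Context: Setting: $C\subset\mathbb{R}^n$ is a nonempty closed convex set contained in an open set $\Omega\subset\mathbb{R}^n$, $F:\Omega\to\mathbb{R}^m$ is continuously differentiable with Jacobian $F'(x)$, and $C^*=\{x\in C: F(x)=0\}$ is assumed nonempty. $\|\cdot\|$ is the Euclidean norm (and the induced operator norm for matrices), $B(x,\rho)=\{y:\|y-x\|\le\rho\}$, and $\operatorname{dist}(x,C^* )=\inf_{y\in C^*}\|y-x\|$. Inexact projection: for $x\in\mathbb{R}^n$, $\varepsilon\ge0$, an $\varepsilon$-projection of $x$ onto $C$, denoted $P_C(x,\varepsilon)$, is any point $p\in C$ with $\langle x-p,y-p\rangle\le\varepsilon$ for all $y\in C$. Method LMM-IP: given $x_0\in C$ and $\{\theta_j\}\subset[0,\infty)$, for $k=0,1,2,\dots$: if $F(x_k)=0$,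 stop; otherwise set $\mu_k=\|F(x_k)\|^2$, let $d_k^U\in\mathbb{R}^n$ solve $(F'(x_k)^TF'(x_k)+\mu_kI)d_k^U=-F'(x_k)^TF(x_k)$, set $\varepsilon_k=\theta_k^2\|d_k^U\|^2$, and let $x_{k+1}=P_C(x_k+d_k^U,\varepsilon_k)$ be any $\varepsilon_k$-projection of $x_k+d_k^U$ onto $C$. It is assumed that the method does not stop, i.e. $F(x_k)\ne0$ for all $k$, so that an infinite sequence is generated. Standing assumptions: (A0) $x_*\in C^*$ is an arbitrary fixed point. (A1) There are $L,\delta_1>0$ (with $B(x_*,\delta_1)\subset\Omega$) such that $\|F'(x)-F'(y)\|\le L\|x-y\|$ for all $x,y\in B(x_*,\delta_1)$. (A2) There are $\omega,\delta_2>0$ (with $B(x_*,\delta_2)\subset\Omega$) such that $\omega\operatorname{dist}(x,C^* )\le\|F(x)\|$ for all $x\in B(x_*,\delta_2)$. Constants: $L_0>0$ is a constant with $\|F(x)-F(y)\|\le L_0\|x-y\|$ for all $x,y\in B(x_*,\delta_1)$; $c_1:=\sqrt{L^2/(4\omega^2)+1}$ and $c_2:=\sqrt{L^2/4+L_0^2}$. A sequence $x_k\to\bar x$ converges linearly if there is $q\in(0,1)$ with $\|x_{k+1}-\bar x\|\le q\|x_k-\bar x\|$ for all sufficiently large $k$; superlinearly if $\|x_{k+1}-\bar x\|/\|x_k-\bar x\|\to0$. *)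

theory Defs
  imports "HOL-Analysis.Analysis"
begin

definition inexact_projection :: "'a::real_inner set \<Rightarrow> 'a \<Rightarrow> real \<Rightarrow> 'a \<Rightarrow> bool" where
  "inexact_projection C x \<epsilon> p \<longleftrightarrow> p \<in> C \<and> (\<forall>y\<in>C. (x - p) \<bullet> (y - p) \<le> \<epsilon>)"

text \<open>The Levenberg-Marquardt equation with regularisation parameter
  \<open>\<mu> = \<parallel>F z\<parallel>\<^sup>2\<close>; \<open>J z\<close> is the Jacobian matrix of \<open>F\<close> at \<open>z\<close>.\<close>

definition lm_step ::
  "(real^'n \<Rightarrow> real^'m) \<Rightarrow> (real^'n \<Rightarrow> real^'n^'m) \<Rightarrow> real^'n \<Rightarrow> real^'n \<Rightarrow> bool" where
  "lm_step F J z d \<longleftrightarrow>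
     (transpose (J z) ** J z + ((norm (F z))\<^sup>2) *\<^sub>R mat 1) *v d = - (transpose (J z) *v F z)"

text \<open>Infinite (non-terminating) runs of the method. Inexact projections are not unique,
  so this is a predicate on sequences.\<close>

definition lmm_ip_sequence ::
  "(real^'n) set \<Rightarrow> (real^'n \<Rightarrow> real^'m) \<Rightarrow> (real^'n \<Rightarrow> real^'n^'m) \<Rightarrow>
   (nat \<Rightarrow> real) \<Rightarrow> (nat \<Rightarrow> real^'n) \<Rightarrow> bool" where
  "lmm_ip_sequence C F J \<theta> x \<longleftrightarrow>
     x 0 \<in> C \<and> (\<forall>k. 0 \<le> \<theta> k) \<and>
     (\<forall>k. F (x k) \<noteq> 0 \<and>
       (\<exists>d. lm_step F J (x k) d \<and>
            inexact_projection C (x k + d) ((\<theta> k)\<^sup>2 * (norm d)\<^sup>2) (x (Suc k))))"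

definition converges_linearly :: "(nat \<Rightarrow> 'a::real_normed_vector) \<Rightarrow> 'a \<Rightarrow> bool" where
  "converges_linearly x l \<longleftrightarrow> x \<longlonglongrightarrow> l \<and>
     (\<exists>q. 0 < q \<and> q < 1 \<and>
       (\<forall>\<^sub>F k in sequentially. norm (x (Suc k) - l) \<le> q * norm (x k - l)))"

text \<open>Since \<open>a / 0 = 0\<close>, the requirement that the quotients are (eventually) well defined
  has to be made explicit.\<close>

definition converges_superlinearly :: "(nat \<Rightarrow> 'a::real_normed_vector) \<Rightarrow> 'a \<Rightarrow> bool" where
  "converges_superlinearly x l \<longleftrightarrow> x \<longlonglongrightarrow> l \<and>
     (\<forall>\<^sub>F k in sequentially. x k \<noteq> l) \<and>
     (\<lambda>k. norm (x (Suc k) - l) / norm (x k - l)) \<longlonglongrightarrow> 0"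

end

theory Submission
  imports Defs
begin

text \<open>
  Write \<open>s = dist (z, C\<^sup>*)\<close> for an iterate \<open>z\<close> near \<open>x\<^sub>*\<close>. The Levenberg-Marquardt step \<open>d\<close> minimises
  the regularised linear model \<open>\<parallel>F z + F' z h\<parallel>\<^sup>2 + \<mu> \<parallel>h\<parallel>\<^sup>2\<close>, so its value there is at most the value at
  \<open>h = w - z\<close>, where \<open>w\<close> is a nearest solution. Since \<open>F w = 0\<close>, the Lipschitz conditions
  make that value \<open>O (s\<^sup>4)\<close>, and the error bound gives \<open>\<mu> = \<parallel>F z\<parallel>\<^sup>2 \<ge> \<omega>\<^sup>2 s\<^sup>2\<close>. It follows that \<open>\<parallel>d\<parallel> \<le> c1 s\<close> and
  \<open>\<parallel>F (z + d)\<parallel> = O (s\<^sup>2)\<close>. The error bound, applied once more at \<open>z + d\<close>, turns the latter into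
  \<open>dist (z + d, C\<^sup>*) = O (s\<^sup>2)\<close>. An inexact projection with tolerance \<open>\<theta>\<^sup>2 \<parallel>d\<parallel>\<^sup>2\<close> increases the distance
  to points of \<open>C\<close> by at most \<open>\<theta> \<parallel>d\<parallel>\<close>, so a full step of the method (\<open>lmm_ip_step\<close>) moves the iterate
  by at most \<open>(1 + \<theta>) c1 s\<close> and changes \<open>s\<close> into at most \<open>(c1 \<theta> + K s) s\<close>.

  Inside the ball of radius \<open>\<sigma> / (2 (1 + c1))\<close> the factor \<open>c1 \<theta> + K s\<close> is at most \<open>\<eta> < 1\<close>. Steps of
  length at most \<open>M s\<close> together with \<open>s\<close> shrinking by \<open>\<eta>\<close> make the potential
  \<open>dist (x\<^sub>k, a) + M s\<^sub>k / (1 - \<eta>)\<close> nonincreasing for every point \<open>a\<close>. With \<open>a = x\<^sub>*\<close> this keeps the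
  iterates in the ball, which is what the choice of \<open>r\<close> provides for; with \<open>a\<close> an earlier iterate it
  gives the Cauchy property and bounds the distance to the limit by a multiple of \<open>s\<^sub>k\<close>.

  The rate must not be read off from \<open>\<eta>\<close>, which may be arbitrarily close to \<open>1\<close>. Since \<open>s\<^sub>k \<rightarrow> 0\<close>, the
  contraction factor is eventually below any \<open>\<beta> > c1 \<alpha>\<close>, and then
  \<open>\<parallel>x\<^bsub>k+1\<^esub> - l\<parallel> \<le> M / (1 - \<beta>) s\<^bsub>k+1\<^esub> \<le> M / (1 - \<beta>) (c1 \<theta>\<^sub>k + K s\<^sub>k) \<parallel>x\<^sub>k - l\<parallel>\<close> for the limit \<open>l\<close>, because
  \<open>l\<close> is a solution and hence \<open>s\<^sub>k \<le> \<parallel>x\<^sub>k - l\<parallel>\<close>. This is linear convergence as soon as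
  \<open>M c1 \<alpha> + c1 \<alpha> < 1\<close> (\<open>rate_from_distance_contraction\<close>), which \<open>\<alpha> = 1 / (4 c1\<^sup>2)\<close> satisfies, and it is
  superlinear when \<open>\<theta>\<^sub>k \<rightarrow> 0\<close>.
\<close>

section \<open>Inexact projections\<close>

text \<open>The defining inequality at \<open>z\<close> gives \<open>t\<^sup>2 \<le> \<epsilon> + t \<parallel>y - z\<parallel>\<close> for \<open>t = \<parallel>p - z\<parallel>\<close>. It serves twice:
  for \<open>z\<close> the current iterate, and for \<open>z\<close> a solution nearest to \<open>y\<close>.\<close>

lemma inexact_projection_dist_le:
  fixes y z p :: "'a::real_inner"
  assumes p: "inexact_projection C y \<epsilon> p" and z: "z \<in> C" and \<epsilon>: "0 \<le> \<epsilon>"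
  shows "norm (p - z) \<le> norm (y - z) + sqrt \<epsilon>"
proof (rule ccontr)
  assume "\<not> ?thesis"
  then have less: "norm (y - z) + sqrt \<epsilon> < norm (p - z)" by simp
  have "(norm (p - z))\<^sup>2 = (y - p) \<bullet> (z - p) + (y - z) \<bullet> (p - z)"
    by (simp add: power2_norm_eq_inner inner_diff_left inner_diff_right inner_commute algebra_simps)
  also have "\<dots> \<le> \<epsilon> + norm (y - z) * norm (p - z)"
    using p z norm_cauchy_schwarz[of "y - z" "p - z"]
    by (intro add_mono) (auto simp: inexact_projection_def)
  finally have "norm (p - z) * (norm (p - z) - norm (y - z)) \<le> sqrt \<epsilon> * sqrt \<epsilon>"
    using \<epsilon> by (simp add: power2_eq_square algebra_simps)
  moreover have "sqrt \<epsilon> * sqrt \<epsilon> < norm (p - z) * (norm (p - z) - norm (y - z))"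
    using less \<epsilon> norm_ge_zero[of "y - z"] real_sqrt_ge_zero[OF \<epsilon>]
    by (intro mult_strict_mono') linarith+
  ultimately show False by simp
qed

section \<open>Linearisation error\<close>

lemma linearisation_error_le:
  fixes F :: "real^'n \<Rightarrow> real^'m" and J :: "real^'n \<Rightarrow> real^'n^'m"
  assumes S: "convex S" "y \<in> S" "z \<in> S"
    and der: "\<And>u. u \<in> S \<Longrightarrow> (F has_derivative (\<lambda>h. J u *v h)) (at u)"
    and lip: "\<And>u v. u \<in> S \<Longrightarrow> v \<in> S \<Longrightarrow> onorm (\<lambda>h. (J u - J v) *v h) \<le> L * norm (u - v)"
  shows "norm (F y - F z - J z *v (y - z)) \<le> L / 2 * (norm (y - z))\<^sup>2"
proof -
  define h where "h = y - z"
  define g where "g = (\<lambda>t. F (z + t *\<^sub>R h) - t *\<^sub>R (J z *v h))"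
  have mem: "z + t *\<^sub>R h \<in> S" if "0 \<le> t" "t \<le> 1" for t
  proof -
    have "z + t *\<^sub>R h = (1 - t) *\<^sub>R z + t *\<^sub>R y" by (simp add: h_def algebra_simps)
    then show ?thesis using convexD[OF S(1) S(3) S(2), of "1 - t" t] that by simp
  qed
  have g': "(g has_vector_derivative (J (z + t *\<^sub>R h) - J z) *v h) (at t)"
    if "0 \<le> t" "t \<le> 1" for t
  proof -
    have "((\<lambda>t. F (z + t *\<^sub>R h)) has_derivative (\<lambda>s. J (z + t *\<^sub>R h) *v (s *\<^sub>R h))) (at t)"
      by (rule has_derivative_compose[where f = "\<lambda>t. z + t *\<^sub>R h", OF _ der[OF mem[OF that]]])
         (auto intro!: derivative_eq_intros)
    then show ?thesis
      unfolding g_def has_vector_derivative_def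
      by (auto intro!: derivative_eq_intros
          simp: matrix_vector_mult_scaleR matrix_vector_mult_diff_rdistrib scaleR_diff_right)
  qed
  have bound: "norm ((J (z + t *\<^sub>R h) - J z) *v h) \<le> L * t * (norm h)\<^sup>2"
    if "0 \<le> t" "t \<le> 1" for t
  proof -
    have "norm ((J (z + t *\<^sub>R h) - J z) *v h) \<le> onorm (\<lambda>v. (J (z + t *\<^sub>R h) - J z) *v v) * norm h"
      by (rule onorm) simp
    also have "\<dots> \<le> (L * norm (z + t *\<^sub>R h - z)) * norm h"
      by (intro mult_right_mono lip mem S that) auto
    finally show ?thesis using that by (simp add: power2_eq_square algebra_simps)
  qed
  have "norm (g 1 - g 0) \<le> L / 2 * 1\<^sup>2 * (norm h)\<^sup>2 - L / 2 * 0\<^sup>2 * (norm h)\<^sup>2"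
  proof (rule differentiable_bound_general[where \<phi>' = "\<lambda>t. L * t * (norm h)\<^sup>2"])
    show "continuous_on {0..1} g"
      using g' by (meson atLeastAtMost_iff continuous_at_imp_continuous_on
          has_vector_derivative_continuous)
    show "((\<lambda>t. L / 2 * t\<^sup>2 * (norm h)\<^sup>2) has_vector_derivative L * t * (norm h)\<^sup>2) (at t)" for t
      unfolding has_real_derivative_iff_has_vector_derivative[symmetric]
      by (auto intro!: derivative_eq_intros)
  qed (auto intro!: continuous_intros g' bound)
  moreover have "g 1 - g 0 = F y - F z - J z *v (y - z)" by (simp add: g_def h_def)
  ultimately show ?thesis by (simp add: h_def)
qed

section \<open>The Levenberg-Marquardt step\<close>

text \<open>The linear system is the stationarity condition of a convex quadratic: writing \<open>h = d + e\<close>, it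
  makes the mixed terms cancel, so that the right-hand side exceeds the left-hand side by
  \<open>\<parallel>J z e\<parallel>\<^sup>2 + \<mu> \<parallel>e\<parallel>\<^sup>2\<close>, where \<open>\<mu> = \<parallel>F z\<parallel>\<^sup>2\<close>.\<close>

lemma lm_step_minimises:
  assumes d: "lm_step F J z d"
  shows "(norm (F z + J z *v d))\<^sup>2 + (norm (F z))\<^sup>2 * (norm d)\<^sup>2
       \<le> (norm (F z + J z *v h))\<^sup>2 + (norm (F z))\<^sup>2 * (norm h)\<^sup>2"
proof -
  define e where "e = h - d"
  define \<mu> where "\<mu> = (norm (F z))\<^sup>2"
  have "transpose (J z) *v (J z *v d) + \<mu> *\<^sub>R d = - (transpose (J z) *v F z)"
    using d by (simp add: lm_step_def \<mu>_def matrix_vector_mult_add_rdistrib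
        matrix_vector_mul_assoc scaleR_matrix_vector_assoc[symmetric])
  then have stationary: "transpose (J z) *v (F z + J z *v d) + \<mu> *\<^sub>R d = 0"
    by (simp add: matrix_vector_right_distrib add.assoc del: transpose_matrix_vector)
  have cross: "(F z + J z *v d) \<bullet> (J z *v e) + \<mu> * (d \<bullet> e) = 0"
  proof -
    have "(F z + J z *v d) \<bullet> (J z *v e) + \<mu> * (d \<bullet> e)
        = (transpose (J z) *v (F z + J z *v d) + \<mu> *\<^sub>R d) \<bullet> e"
      by (simp add: inner_add_left dot_lmul_matrix[symmetric] transpose_matrix_vector)
    then show ?thesis using stationary by simp
  qed
  have "F z + J z *v h = (F z + J z *v d) + J z *v e" and "h = d + e"
    by (simp_all add: e_def matrix_vector_mult_diff_distrib)
  then have "(norm (F z + J z *v h))\<^sup>2 + \<mu> * (norm h)\<^sup>2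
      = (norm (F z + J z *v d))\<^sup>2 + \<mu> * (norm d)\<^sup>2 + (norm (J z *v e))\<^sup>2 + \<mu> * (norm e)\<^sup>2
        + 2 * ((F z + J z *v d) \<bullet> (J z *v e) + \<mu> * (d \<bullet> e))"
    by (simp only: power2_norm_eq_inner inner_add_left inner_add_right)
       (simp add: inner_commute algebra_simps)
  moreover have "0 \<le> \<mu> * (norm e)\<^sup>2" by (simp add: \<mu>_def)
  ultimately show ?thesis using cross by (simp add: \<mu>_def)
qed

text \<open>The competitor \<open>h = w - z\<close> has residual \<open>O (\<parallel>w - z\<parallel>\<^sup>2)\<close>. Dropping one of the two summands of the
  minimal value bounds the other. For \<open>d\<close> one divides by \<open>\<mu> = \<parallel>F z\<parallel>\<^sup>2 \<ge> \<omega>\<^sup>2 \<parallel>w - z\<parallel>\<^sup>2\<close>; for the residual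
  one uses \<open>\<mu> \<le> L0\<^sup>2 \<parallel>w - z\<parallel>\<^sup>2\<close>.\<close>

lemma lm_step_bounds:
  assumes d: "lm_step F J z d" and "F z \<noteq> 0" and \<omega>: "0 < \<omega>"
    and res: "norm (F z + J z *v (w - z)) \<le> L / 2 * (norm (w - z))\<^sup>2"
    and low: "\<omega> * norm (w - z) \<le> norm (F z)"
    and up: "norm (F z) \<le> L0 * norm (w - z)"
  shows lm_step_norm_le: "norm d \<le> sqrt (L\<^sup>2 / (4 * \<omega>\<^sup>2) + 1) * norm (w - z)"
    and lm_step_residual_le: "norm (F z + J z *v d) \<le> sqrt (L\<^sup>2 / 4 + L0\<^sup>2) * (norm (w - z))\<^sup>2"
proof -
  define s where "s = norm (w - z)"
  define \<mu> where "\<mu> = (norm (F z))\<^sup>2"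
  have \<mu>: "0 < \<mu>" using \<open>F z \<noteq> 0\<close> by (simp add: \<mu>_def)
  have s: "0 \<le> s" by (simp add: s_def)
  have \<mu>_ge: "\<omega>\<^sup>2 * s\<^sup>2 \<le> \<mu>"
    using power_mono[OF low, of 2] \<omega> by (simp add: \<mu>_def s_def power_mult_distrib)
  have \<mu>_le: "\<mu> \<le> L0\<^sup>2 * s\<^sup>2"
    using power_mono[OF up, of 2] by (simp add: \<mu>_def s_def power_mult_distrib)
  have "(norm (F z + J z *v (w - z)))\<^sup>2 \<le> L\<^sup>2 / 4 * s\<^sup>2 * s\<^sup>2"
    using power_mono[OF res, of 2]
    by (simp add: s_def power_mult_distrib power_divide power2_eq_square algebra_simps)
  then have min: "(norm (F z + J z *v d))\<^sup>2 + \<mu> * (norm d)\<^sup>2 \<le> L\<^sup>2 / 4 * s\<^sup>2 * s\<^sup>2 + \<mu> * s\<^sup>2"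
    using lm_step_minimises[OF d, of "w - z"] by (simp add: s_def \<mu>_def)
  have "L\<^sup>2 / 4 * s\<^sup>2 * s\<^sup>2 = (L\<^sup>2 / (4 * \<omega>\<^sup>2) * s\<^sup>2) * (\<omega>\<^sup>2 * s\<^sup>2)"
    using \<omega> by (simp add: field_simps)
  also have "\<dots> \<le> (L\<^sup>2 / (4 * \<omega>\<^sup>2) * s\<^sup>2) * \<mu>"
    by (rule mult_left_mono[OF \<mu>_ge]) simp
  finally have "\<mu> * (norm d)\<^sup>2 \<le> \<mu> * ((L\<^sup>2 / (4 * \<omega>\<^sup>2) + 1) * s\<^sup>2)"
    using min zero_le_power2[of "norm (F z + J z *v d)"]
    by (simp only: distrib_left distrib_right mult_1 mult_ac)
  then have "(norm d)\<^sup>2 \<le> (sqrt (L\<^sup>2 / (4 * \<omega>\<^sup>2) + 1) * s)\<^sup>2"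
    using \<mu> by (simp add: power_mult_distrib)
  then show "norm d \<le> sqrt (L\<^sup>2 / (4 * \<omega>\<^sup>2) + 1) * norm (w - z)"
    unfolding s_def by (rule power2_le_imp_le) simp
  have "\<mu> * s\<^sup>2 \<le> L0\<^sup>2 * s\<^sup>2 * s\<^sup>2" by (rule mult_right_mono[OF \<mu>_le]) simp
  moreover have "0 \<le> \<mu> * (norm d)\<^sup>2" using \<mu> by simp
  ultimately have "(norm (F z + J z *v d))\<^sup>2 \<le> (L\<^sup>2 / 4 + L0\<^sup>2) * s\<^sup>2 * s\<^sup>2"
    using min by (simp add: distrib_right)
  then have "(norm (F z + J z *v d))\<^sup>2 \<le> (sqrt (L\<^sup>2 / 4 + L0\<^sup>2) * s\<^sup>2)\<^sup>2"
    by (simp add: power_mult_distrib power2_eq_square[of "s\<^sup>2"] mult.assoc)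
  then show "norm (F z + J z *v d) \<le> sqrt (L\<^sup>2 / 4 + L0\<^sup>2) * (norm (w - z))\<^sup>2"
    unfolding s_def by (rule power2_le_imp_le) simp
qed

section \<open>One step of the method\<close>

text \<open>The radius \<open>\<delta> / (1 + c1)\<close> ensures that the two points used besides \<open>z\<close> stay in the ball of radius
  \<open>\<delta>\<close>: the unconstrained point \<open>z + d\<close>, since \<open>\<parallel>d\<parallel> \<le> c1 \<parallel>z - xstar\<parallel>\<close>, and the solution \<open>w\<close> nearest to
  \<open>z\<close>, whose distance from \<open>xstar\<close> is at most \<open>2 \<parallel>z - xstar\<parallel>\<close>, where \<open>1 \<le> c1\<close>.\<close>

lemma lmm_ip_step:
  fixes C :: "(real^'n) set" and F :: "real^'n \<Rightarrow> real^'m" and J :: "real^'n \<Rightarrow> real^'n^'m"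
    and L L0 \<omega> :: real
  defines "c1 \<equiv> sqrt (L\<^sup>2 / (4 * \<omega>\<^sup>2) + 1)" and "c2 \<equiv> sqrt (L\<^sup>2 / 4 + L0\<^sup>2)"
    and "S \<equiv> {u \<in> C. F u = 0}"
  assumes S: "closed S" "xstar \<in> S" and L: "0 \<le> L" and \<omega>: "0 < \<omega>"
    and der: "\<And>u. u \<in> cball xstar \<delta> \<Longrightarrow> (F has_derivative (\<lambda>h. J u *v h)) (at u)"
    and J_lip: "\<And>u v. u \<in> cball xstar \<delta> \<Longrightarrow> v \<in> cball xstar \<delta> \<Longrightarrow>
           onorm (\<lambda>h. (J u - J v) *v h) \<le> L * norm (u - v)"
    and err: "\<And>u. u \<in> cball xstar \<delta> \<Longrightarrow> \<omega> * infdist u S \<le> norm (F u)"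
    and F_lip: "\<And>u v. u \<in> cball xstar \<delta> \<Longrightarrow> v \<in> cball xstar \<delta> \<Longrightarrow>
           norm (F u - F v) \<le> L0 * norm (u - v)"
    and z: "z \<in> C" "F z \<noteq> 0" "(1 + c1) * norm (z - xstar) \<le> \<delta>"
    and d: "lm_step F J z d" and \<theta>: "0 \<le> \<theta>"
    and p: "inexact_projection C (z + d) (\<theta>\<^sup>2 * (norm d)\<^sup>2) p"
  shows lmm_ip_step_length: "norm (p - z) \<le> (1 + \<theta>) * c1 * infdist z S"
    and lmm_ip_step_contraction:
      "infdist p S \<le> (c1 * \<theta> + (2 * c2 + L * c1\<^sup>2) / (2 * \<omega>) * infdist z S) * infdist z S"
proof -
  define s where "s = infdist z S"
  have ne: "S \<noteq> {}" using S by auto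
  have c1: "1 \<le> c1" by (simp add: c1_def)
  have s0: "0 \<le> s" by (simp add: s_def infdist_nonneg)
  have s_le: "s \<le> norm (z - xstar)"
    using infdist_le[OF S(2), of z] by (simp add: s_def dist_norm)
  obtain w where w: "w \<in> S" "infdist z S = dist z w"
    using infdist_attains_inf[OF S(1) ne] by blast
  have w_s: "norm (w - z) = s" using w by (simp add: s_def dist_norm norm_minus_commute)
  have two: "2 * norm (z - xstar) \<le> (1 + c1) * norm (z - xstar)"
    using c1 by (intro mult_right_mono) auto
  have "norm (z - xstar) \<le> \<delta>" using two z(3) norm_ge_zero[of "z - xstar"] by linarith
  then have z_in: "z \<in> cball xstar \<delta>" by (simp add: dist_norm norm_minus_commute)
  have "norm (w - xstar) \<le> \<delta>"
    using norm_triangle_ineq[of "w - z" "z - xstar"] w_s s_le two z(3) by simp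
  then have w_in: "w \<in> cball xstar \<delta>" by (simp add: dist_norm norm_minus_commute)
  have Fw: "F w = 0" using w by (simp add: S_def)
  have "norm (F z + J z *v (w - z)) = norm (F w - F z - J z *v (w - z))"
    using norm_minus_cancel[of "F z + J z *v (w - z)"] Fw by simp
  then have res: "norm (F z + J z *v (w - z)) \<le> L / 2 * (norm (w - z))\<^sup>2"
    using linearisation_error_le[OF convex_cball w_in z_in der J_lip] by simp
  have low: "\<omega> * norm (w - z) \<le> norm (F z)" using err[OF z_in] w_s by (simp add: s_def)
  have up: "norm (F z) \<le> L0 * norm (w - z)"
    using F_lip[OF z_in w_in] Fw by (simp add: norm_minus_commute)
  have d_le: "norm d \<le> c1 * s"
    using lm_step_norm_le[OF d z(2) \<omega> res low up] by (simp add: c1_def w_s)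
  have lin: "norm (F z + J z *v d) \<le> c2 * s\<^sup>2"
    using lm_step_residual_le[OF d z(2) \<omega> res low up] by (simp add: c2_def w_s)
  have sqrt_eq: "sqrt (\<theta>\<^sup>2 * (norm d)\<^sup>2) = \<theta> * norm d"
    using \<theta> by (simp add: real_sqrt_mult)
  have \<theta>d: "\<theta> * norm d \<le> \<theta> * (c1 * s)" by (rule mult_left_mono[OF d_le \<theta>])

  have "norm (p - z) \<le> norm d + \<theta> * norm d"
    using inexact_projection_dist_le[OF p z(1)] by (simp add: sqrt_eq)
  then show "norm (p - z) \<le> (1 + \<theta>) * c1 * infdist z S"
    using d_le \<theta>d by (simp add: s_def algebra_simps)

  have "c1 * s \<le> c1 * norm (z - xstar)" using s_le c1 by (intro mult_left_mono) auto
  then have zd_in: "z + d \<in> cball xstar \<delta>"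
    using norm_triangle_ineq[of "z - xstar" d] d_le z(3)
    by (simp add: dist_norm norm_minus_commute[of xstar] algebra_simps)
  have "F (z + d) = (F z + J z *v d) + (F (z + d) - F z - J z *v (z + d - z))" by simp
  then have "norm (F (z + d)) \<le> norm (F z + J z *v d) + norm (F (z + d) - F z - J z *v (z + d - z))"
    by (metis norm_triangle_ineq)
  also have "\<dots> \<le> c2 * s\<^sup>2 + L / 2 * (norm d)\<^sup>2"
    using linearisation_error_le[OF convex_cball zd_in z_in der J_lip] lin by simp
  also have "\<dots> \<le> c2 * s\<^sup>2 + L / 2 * (c1 * s)\<^sup>2"
    using power_mono[OF d_le norm_ge_zero, of 2] L by (simp add: mult_left_mono)
  also have "\<dots> = (2 * c2 + L * c1\<^sup>2) / 2 * s\<^sup>2"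
    by (simp add: power_mult_distrib field_simps)
  finally have "\<omega> * infdist (z + d) S \<le> (2 * c2 + L * c1\<^sup>2) / 2 * s\<^sup>2"
    using err[OF zd_in] by linarith
  then have zd: "infdist (z + d) S \<le> (2 * c2 + L * c1\<^sup>2) / (2 * \<omega>) * s\<^sup>2"
    using \<omega> by (simp add: field_simps)
  obtain v where v: "v \<in> S" "infdist (z + d) S = dist (z + d) v"
    using infdist_attains_inf[OF S(1) ne] by blast
  have "v \<in> C" using v by (simp add: S_def)
  have "infdist p S \<le> norm (p - v)"
    using infdist_le[OF v(1), of p] by (simp add: dist_norm)
  also have "\<dots> \<le> norm (z + d - v) + \<theta> * norm d"
    using inexact_projection_dist_le[OF p \<open>v \<in> C\<close>] by (simp add: sqrt_eq)
  also have "\<dots> \<le> (2 * c2 + L * c1\<^sup>2) / (2 * \<omega>) * s\<^sup>2 + \<theta> * (c1 * s)"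
    using zd v \<theta>d by (simp add: dist_norm)
  finally show "infdist p S \<le>
      (c1 * \<theta> + (2 * c2 + L * c1\<^sup>2) / (2 * \<omega>) * infdist z S) * infdist z S"
    by (simp add: s_def power2_eq_square algebra_simps)
qed

section \<open>Convergence rates from contraction of the distance to a set\<close>

text \<open>The remaining steps have total length at most \<open>M * s / (1 - \<beta>)\<close> by the geometric series. Adding
  this travel allowance to the distance from any point \<open>a\<close> gives a quantity that cannot grow.\<close>

lemma potential_decreases:
  fixes x y a :: "'a::metric_space"
  assumes "dist y x \<le> M * s" and "s' \<le> \<beta> * s" and "0 \<le> M" and "\<beta> < 1"
  shows "dist y a + M / (1 - \<beta>) * s' \<le> dist x a + M / (1 - \<beta>) * s"
proof -
  have "M / (1 - \<beta>) * s' \<le> M / (1 - \<beta>) * (\<beta> * s)"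
    using assms by (intro mult_left_mono) auto
  moreover have "M * s + M / (1 - \<beta>) * (\<beta> * s) = M / (1 - \<beta>) * s"
    using \<open>\<beta> < 1\<close> by (simp add: field_simps)
  ultimately show ?thesis
    using dist_triangle[of y a x] assms(1) by linarith
qed

lemma later_dist_le:
  fixes x :: "nat \<Rightarrow> 'a::metric_space"
  assumes step: "\<And>k. k \<ge> N \<Longrightarrow> dist (x (Suc k)) (x k) \<le> M * s k"
    and contr: "\<And>k. k \<ge> N \<Longrightarrow> s (Suc k) \<le> \<beta> * s k"
    and s: "\<And>k. 0 \<le> s k" and M: "0 \<le> M" and \<beta>: "\<beta> < 1" and n: "N \<le> n" "n \<le> m"
  shows "dist (x m) (x n) \<le> M / (1 - \<beta>) * s n"
proof -
  have "dist (x m) (x n) + M / (1 - \<beta>) * s m \<le> M / (1 - \<beta>) * s n"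
    using n(2)
  proof (induction m rule: dec_induct)
    case (step m)
    then show ?case
      using potential_decreases[OF assms(1) contr M \<beta>, of m "x n"] n(1) by fastforce
  qed simp
  moreover have "0 \<le> M / (1 - \<beta>) * s m" using M \<beta> s by simp
  ultimately show ?thesis by linarith
qed

text \<open>The uniform factor \<open>\<eta>\<close> gives convergence to a point \<open>l\<close> of \<open>S\<close>. The rate comes from the tail:
  \<open>M * (c * \<alpha>) + c * \<alpha> < 1\<close> leaves room for a \<open>\<beta>\<close> with \<open>c * \<alpha> < \<beta>\<close> and \<open>M * (c * \<alpha>) < 1 - \<beta>\<close>; the first
  inequality makes \<open>\<beta>\<close> an eventual contraction factor, and with the second one the resulting estimate
  \<open>M / (1 - \<beta>) * (c * \<theta> k + K * s k)\<close> of the quotients of the errors is eventually below \<open>1\<close>.\<close>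

lemma rate_from_distance_contraction:
  fixes x :: "nat \<Rightarrow> 'a::banach"
  assumes S: "closed S" "S \<noteq> {}" and out: "\<And>k. x k \<notin> S"
    and step: "\<And>k. norm (x (Suc k) - x k) \<le> M * infdist (x k) S"
    and unif: "\<And>k. infdist (x (Suc k)) S \<le> \<eta> * infdist (x k) S" and \<eta>: "0 \<le> \<eta>" "\<eta> < 1"
    and contr: "\<And>k. infdist (x (Suc k)) S \<le> (c * \<theta> k + K * infdist (x k) S) * infdist (x k) S"
    and nonneg: "0 \<le> M" "0 \<le> c" "0 \<le> K" and \<theta>: "\<And>k. 0 \<le> \<theta> k" "\<And>k. \<theta> k \<le> \<alpha>"
    and small: "M * (c * \<alpha>) + c * \<alpha> < 1"
  shows "\<exists>l. converges_linearly x l \<and> (\<theta> \<longlonglongrightarrow> 0 \<longrightarrow> converges_superlinearly x l)"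
proof -
  define s where "s k = infdist (x k) S" for k
  have s0: "0 \<le> s k" for k by (simp add: s_def infdist_nonneg)
  have dstep: "dist (x (Suc k)) (x k) \<le> M * s k" for k
    using step by (simp add: s_def dist_norm)
  have s_geom: "s k \<le> \<eta> ^ k * s 0" for k
  proof (induction k)
    case (Suc k)
    have "s (Suc k) \<le> \<eta> * s k" using unif by (simp add: s_def)
    also have "\<dots> \<le> \<eta> * (\<eta> ^ k * s 0)" by (rule mult_left_mono[OF Suc \<eta>(1)])
    finally show ?case by (simp add: mult.assoc)
  qed simp
  have "(\<lambda>k. \<eta> ^ k * s 0) \<longlonglongrightarrow> 0"
    using tendsto_mult_left_zero[OF LIMSEQ_realpow_zero[OF \<eta>]] .
  then have s_lim: "s \<longlonglongrightarrow> 0"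
    by (rule tendsto_sandwich[OF _ _ tendsto_const, rotated 2]) (auto simp: s0 s_geom)

  have later: "dist (x m) (x n) \<le> M / (1 - \<eta>) * s n" if "n \<le> m" for m n
    using later_dist_le[of 0 x M s \<eta> n m] dstep unif s0 nonneg \<eta> that by (simp add: s_def)
  have "Cauchy x"
  proof (rule metric_CauchyI)
    fix e :: real assume "0 < e"
    have "(\<lambda>n. M / (1 - \<eta>) * s n) \<longlonglongrightarrow> 0" using tendsto_mult_right_zero[OF s_lim] .
    then have "\<forall>\<^sub>F n in sequentially. M / (1 - \<eta>) * s n < e / 2"
      by (rule order_tendstoD) (use \<open>0 < e\<close> in simp)
    then obtain N where N: "M / (1 - \<eta>) * s N < e / 2"
      by (auto simp: eventually_sequentially)
    have "dist (x m) (x n) < e" if "N \<le> m" "N \<le> n" for m n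
      using later[OF that(1)] later[OF that(2)] dist_triangle2[of "x m" "x n" "x N"] N by linarith
    then show "\<exists>N. \<forall>m\<ge>N. \<forall>n\<ge>N. dist (x m) (x n) < e" by blast
  qed
  then obtain l where l: "x \<longlonglongrightarrow> l" using Cauchy_convergent convergent_def by blast
  have "s \<longlonglongrightarrow> infdist l S" unfolding s_def by (intro tendsto_infdist l)
  then have "infdist l S = 0" using s_lim LIMSEQ_unique by blast
  then have lS: "l \<in> S" using in_closed_iff_infdist_zero[OF S] by simp
  have s_le: "s k \<le> norm (x k - l)" for k
    using infdist_le[OF lS, of "x k"] by (simp add: s_def dist_norm)

  define \<beta> where "\<beta> = (c * \<alpha> + (1 - M * (c * \<alpha>))) / 2"
  have \<alpha>: "0 \<le> c * \<alpha>" using nonneg \<theta>[of 0] by simp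
  then have M\<alpha>: "0 \<le> M * (c * \<alpha>)" using nonneg by simp
  have \<beta>: "c * \<alpha> < \<beta>" "M * (c * \<alpha>) < 1 - \<beta>" using small by (simp_all add: \<beta>_def field_simps)
  have \<beta>1: "\<beta> < 1" using \<beta> M\<alpha> by linarith
  define D where "D = M / (1 - \<beta>)"
  have D0: "0 \<le> D" using nonneg \<beta>1 by (simp add: D_def)
  have D\<alpha>: "D * (c * \<alpha>) < 1" using \<beta> \<beta>1 by (simp add: D_def field_simps)
  have lim: "(\<lambda>k. c * \<alpha> + K * s k) \<longlonglongrightarrow> c * \<alpha> + K * 0" by (intro tendsto_intros s_lim)
  have "\<forall>\<^sub>F k in sequentially. c * \<alpha> + K * s k < \<beta>"
    using order_tendstoD(2)[OF lim, of \<beta>] \<beta> by simp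
  then obtain N where N: "\<And>k. k \<ge> N \<Longrightarrow> c * \<alpha> + K * s k < \<beta>"
    by (auto simp: eventually_sequentially)
  have factor: "c * \<theta> k + K * s k \<le> c * \<alpha> + K * s k" for k
    using \<theta>(2) nonneg by (simp add: mult_left_mono)
  have contr_s: "s (Suc k) \<le> (c * \<theta> k + K * s k) * s k" for k
    using contr by (simp add: s_def)
  have contr_\<beta>: "s (Suc k) \<le> \<beta> * s k" if "k \<ge> N" for k
  proof -
    have "(c * \<theta> k + K * s k) * s k \<le> \<beta> * s k"
      using factor[of k] N[OF that] by (intro mult_right_mono s0) linarith
    then show ?thesis using contr_s[of k] by linarith
  qed
  have dist_l: "norm (x n - l) \<le> D * s n" if "n \<ge> N" for n
  proof -
    have "(\<lambda>m. dist (x m) (x n)) \<longlonglongrightarrow> dist l (x n)" by (intro tendsto_intros l)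
    moreover have "dist (x m) (x n) \<le> D * s n" if "m \<ge> n" for m
      unfolding D_def using later_dist_le[of N x M s \<beta> n m] dstep contr_\<beta> s0 nonneg \<beta>1 \<open>n \<ge> N\<close> that
      by blast
    ultimately have "dist l (x n) \<le> D * s n" by (intro LIMSEQ_le_const2) auto
    then show ?thesis by (simp add: dist_norm norm_minus_commute)
  qed
  have rate: "norm (x (Suc k) - l) \<le> D * (c * \<theta> k + K * s k) * norm (x k - l)" if "k \<ge> N" for k
  proof -
    have "norm (x (Suc k) - l) \<le> D * s (Suc k)" using dist_l that by simp
    also have "\<dots> \<le> D * ((c * \<theta> k + K * s k) * norm (x k - l))"
    proof (rule mult_left_mono[OF _ D0])
      have "0 \<le> c * \<theta> k + K * s k" using nonneg \<theta> s0 by simp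
      then have "(c * \<theta> k + K * s k) * s k \<le> (c * \<theta> k + K * s k) * norm (x k - l)"
        by (rule mult_left_mono[OF s_le])
      then show "s (Suc k) \<le> (c * \<theta> k + K * s k) * norm (x k - l)"
        using contr_s[of k] by linarith
    qed
    finally show ?thesis by (simp add: mult.assoc)
  qed

  obtain q where q: "D * (c * \<alpha>) < q" "q < 1" using dense[OF D\<alpha>] by blast
  have "0 \<le> D * (c * \<alpha>)" using D0 \<alpha> by simp
  then have q0: "0 < q" using q(1) by linarith
  have "\<forall>\<^sub>F k in sequentially. D * (c * \<alpha> + K * s k) < q"
    using order_tendstoD(2)[OF tendsto_mult_left[OF lim, of D], of q] q by simp
  then have "\<forall>\<^sub>F k in sequentially. norm (x (Suc k) - l) \<le> q * norm (x k - l)"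
    using eventually_ge_at_top[of N]
  proof eventually_elim
    case (elim k)
    have "D * (c * \<theta> k + K * s k) \<le> q"
      using mult_left_mono[OF factor[of k] D0] elim(1) by linarith
    then have "D * (c * \<theta> k + K * s k) * norm (x k - l) \<le> q * norm (x k - l)"
      by (intro mult_right_mono) auto
    then show ?case using rate[OF elim(2)] by linarith
  qed
  then have "converges_linearly x l" using l q(2) q0 by (auto simp: converges_linearly_def)
  moreover have "converges_superlinearly x l" if "\<theta> \<longlonglongrightarrow> 0"
  proof -
    have ne: "x k \<noteq> l" for k using out[of k] lS by auto
    have "(\<lambda>k. D * (c * \<theta> k + K * s k)) \<longlonglongrightarrow> D * (c * 0 + K * 0)"
      by (intro tendsto_intros that s_lim)
    then have bound_lim: "(\<lambda>k. D * (c * \<theta> k + K * s k)) \<longlonglongrightarrow> 0" by simp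
    have "\<forall>\<^sub>F k in sequentially.
        norm (x (Suc k) - l) / norm (x k - l) \<le> D * (c * \<theta> k + K * s k)"
      using eventually_ge_at_top[of N]
    proof eventually_elim
      case (elim k)
      then show ?case using rate[OF elim] ne[of k] by (simp add: divide_le_eq)
    qed
    then have "(\<lambda>k. norm (x (Suc k) - l) / norm (x k - l)) \<longlonglongrightarrow> 0"
      by (intro tendsto_sandwich[OF _ _ tendsto_const bound_lim]) simp_all
    then show ?thesis using l ne by (simp add: converges_superlinearly_def)
  qed
  ultimately show ?thesis by blast
qed

section \<open>Local convergence of the method\<close>

theorem theorem9:
  fixes C \<Omega> Cstar :: "(real^'n) set"
    and F :: "real^'n \<Rightarrow> real^'m"
    and F' :: "real^'n \<Rightarrow> real^'n^'m"
    and xstar :: "real^'n"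
    and L L0 \<omega> \<delta>1 \<delta>2 c1 c2 :: real
  assumes "open \<Omega>" and "C \<subseteq> \<Omega>" and "C \<noteq> {}" and "closed C" and "convex C"
    and "\<And>z. z \<in> \<Omega> \<Longrightarrow> (F has_derivative (\<lambda>h. F' z *v h)) (at z)"
    and "continuous_on \<Omega> F'"
    and "Cstar = {z \<in> C. F z = 0}" and "Cstar \<noteq> {}"
    and "xstar \<in> Cstar"
    and "L > 0" and "\<delta>1 > 0" and "cball xstar \<delta>1 \<subseteq> \<Omega>"
    and "\<And>y z. y \<in> cball xstar \<delta>1 \<Longrightarrow> z \<in> cball xstar \<delta>1 \<Longrightarrow>
           onorm (\<lambda>h. (F' y - F' z) *v h) \<le> L * norm (y - z)"
    and "\<omega> > 0" and "\<delta>2 > 0" and "cball xstar \<delta>2 \<subseteq> \<Omega>"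
    and "\<And>z. z \<in> cball xstar \<delta>2 \<Longrightarrow> \<omega> * infdist z Cstar \<le> norm (F z)"
    and "L0 > 0"
    and "\<And>y z. y \<in> cball xstar \<delta>1 \<Longrightarrow> z \<in> cball xstar \<delta>1 \<Longrightarrow>
           norm (F y - F z) \<le> L0 * norm (y - z)"
    and "c1 = sqrt (L\<^sup>2 / (4 * \<omega>\<^sup>2) + 1)"
    and "c2 = sqrt (L\<^sup>2 / 4 + L0\<^sup>2)"
  shows "\<exists>\<alpha>. 0 < \<alpha> \<and> \<alpha> < 1 / c1 \<and>
    (\<forall>\<sigma> \<eta> r. 0 < \<sigma> \<longrightarrow>
       \<sigma> < Min {\<delta>1, \<delta>2, 4 * \<omega> * (1 - \<alpha> * c1) / (2 * c2 + L * c1\<^sup>2)} \<longrightarrow>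
       \<eta> = \<alpha> * c1 + (2 * c2 + L * c1\<^sup>2) * \<sigma> / (4 * \<omega>) \<longrightarrow>
       r = \<sigma> * (1 - \<eta>) / (2 * (1 + c1) * (1 - \<eta> + (1 + \<alpha>) * c1)) \<longrightarrow>
       (\<forall>x \<theta>. lmm_ip_sequence C F F' \<theta> x \<longrightarrow> x 0 \<in> cball xstar r \<inter> C \<longrightarrow>
          (\<forall>k. \<theta> k \<in> {0..<\<alpha>}) \<longrightarrow>
          (\<exists>xbar. converges_linearly x xbar \<and>
                  (\<theta> \<longlonglongrightarrow> 0 \<longrightarrow> converges_superlinearly x xbar))))"
proof -
  define \<alpha> where "\<alpha> = 1 / (4 * c1\<^sup>2)"
  define A where "A = 2 * c2 + L * c1\<^sup>2"
  have c1: "1 \<le> c1" using assms(21) by simp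
  have "0 \<le> c2" using assms(22) by simp
  then have A: "0 < A"
    using \<open>L > 0\<close> c1 by (auto simp: A_def intro!: add_nonneg_pos mult_pos_pos)
  have \<alpha>0: "0 < \<alpha>" using c1 by (simp add: \<alpha>_def)
  have c1\<alpha>: "c1 * (c1 * \<alpha>) = 1 / 4" using c1 by (simp add: \<alpha>_def power2_eq_square)
  have "1 * (c1 * \<alpha>) \<le> c1 * (c1 * \<alpha>)" using c1 \<alpha>0 by (intro mult_right_mono) auto
  then have c1\<alpha>': "c1 * \<alpha> \<le> 1 / 4" using c1\<alpha> by simp
  have "1 * \<alpha> \<le> c1 * \<alpha>" using c1 \<alpha>0 by (intro mult_right_mono) auto
  then have \<alpha>4: "\<alpha> \<le> 1 / 4" using c1\<alpha>' by simp
  have \<alpha>1: "\<alpha> < 1 / c1" using c1 c1\<alpha>' by (simp add: field_simps)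
  have small: "(1 + \<alpha>) * c1 * (c1 * \<alpha>) + c1 * \<alpha> < 1"
  proof -
    have "(1 + \<alpha>) * c1 * (c1 * \<alpha>) = 1 / 4 + \<alpha> / 4"
      by (simp only: mult.assoc c1\<alpha>) simp
    moreover have "1 / 4 + \<alpha> / 4 + c1 * \<alpha> < 1" using c1\<alpha>' \<alpha>4 by linarith
    ultimately show ?thesis by (simp only:)
  qed
  have "continuous_on C F"
    using assms(2,6) by (meson continuous_at_imp_continuous_on has_derivative_continuous subsetD)
  then have closed: "closed Cstar"
    using continuous_closed_preimage_constant[OF _ \<open>closed C\<close>, of F 0] assms(8) by simp

  have "\<exists>xbar. converges_linearly x xbar \<and> (\<theta> \<longlonglongrightarrow> 0 \<longrightarrow> converges_superlinearly x xbar)"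
    if \<sigma>0: "0 < \<sigma>"
      and \<sigma>: "\<sigma> < Min {\<delta>1, \<delta>2, 4 * \<omega> * (1 - \<alpha> * c1) / (2 * c2 + L * c1\<^sup>2)}"
      and \<eta>_def: "\<eta> = \<alpha> * c1 + (2 * c2 + L * c1\<^sup>2) * \<sigma> / (4 * \<omega>)"
      and r_def: "r = \<sigma> * (1 - \<eta>) / (2 * (1 + c1) * (1 - \<eta> + (1 + \<alpha>) * c1))"
      and seq: "lmm_ip_sequence C F F' \<theta> x" and x0: "x 0 \<in> cball xstar r \<inter> C"
      and \<theta>: "\<forall>k. \<theta> k \<in> {0..<\<alpha>}"
    for \<sigma> \<eta> r x \<theta>
  proof -
    define s where "s k = infdist (x k) Cstar" for k
    define M where "M = (1 + \<alpha>) * c1"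
    define K where "K = A / (2 * \<omega>)"
    define \<rho> where "\<rho> = \<sigma> / (2 * (1 + c1))"
    have \<sigma>_le: "\<sigma> < \<delta>1" "\<sigma> < \<delta>2" "\<sigma> < 4 * \<omega> * (1 - \<alpha> * c1) / A"
      using \<sigma> by (simp_all add: A_def)
    have \<eta>: "\<eta> = c1 * \<alpha> + K * (\<sigma> / 2)" by (simp add: \<eta>_def K_def A_def mult.commute)
    have \<eta>1: "\<eta> < 1" using \<sigma>_le(3) A \<open>\<omega> > 0\<close> by (simp add: \<eta> K_def field_simps)
    have K0: "0 \<le> K" using A \<open>\<omega> > 0\<close> by (simp add: K_def)
    have \<eta>0: "0 \<le> \<eta>" using K0 \<sigma>0 c1 \<alpha>0 by (simp add: \<eta>)
    have M0: "0 < M" using c1 \<alpha>0 by (simp add: M_def)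
    have \<rho>: "(1 + c1) * \<rho> = \<sigma> / 2" using c1 by (simp add: \<rho>_def field_simps)
    have \<rho>\<sigma>: "\<rho> \<le> \<sigma> / 2" using c1 \<sigma>0 by (simp add: \<rho>_def field_simps)
    have C: "x k \<in> C" for k
    proof (cases k)
      case (Suc j)
      then show ?thesis using seq by (auto simp: lmm_ip_sequence_def inexact_projection_def)
    qed (use x0 in simp)
    have Fne: "F (x k) \<noteq> 0" for k using seq by (simp add: lmm_ip_sequence_def)
    have s_le: "s k \<le> dist (x k) xstar" for k unfolding s_def by (rule infdist_le[OF assms(10)])
    have s0: "0 \<le> s k" for k by (simp add: s_def infdist_nonneg)

    have step: "norm (x (Suc k) - x k) \<le> M * s k"
        "s (Suc k) \<le> (c1 * \<theta> k + K * s k) * s k" "s (Suc k) \<le> \<eta> * s k"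
      if near: "dist (x k) xstar \<le> \<rho>" for k
    proof -
      obtain d where d: "lm_step F F' (x k) d"
        "inexact_projection C (x k + d) ((\<theta> k)\<^sup>2 * (norm d)\<^sup>2) (x (Suc k))"
        using seq unfolding lmm_ip_sequence_def by blast
      have "(1 + c1) * norm (x k - xstar) \<le> (1 + c1) * \<rho>"
        using near c1 by (intro mult_left_mono) (auto simp: dist_norm)
      then have near': "(1 + c1) * norm (x k - xstar) \<le> \<sigma>" using \<rho> \<sigma>0 by linarith
      have ball: "u \<in> cball xstar \<delta>1" "u \<in> cball xstar \<delta>2" if "u \<in> cball xstar \<sigma>" for u
        using that \<sigma>_le by auto
      have \<theta>0: "0 \<le> \<theta> k" "\<theta> k \<le> \<alpha>" using \<theta>[rule_format, of k] by auto
      note facts = closed[unfolded assms(8)] assms(10)[unfolded assms(8)]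
        order.strict_implies_order[OF \<open>L > 0\<close>] \<open>\<omega> > 0\<close>
        assms(6)[OF subsetD[OF assms(13) ball(1)]] assms(14)[OF ball(1) ball(1)]
        assms(18)[OF ball(2), unfolded assms(8)] assms(20)[OF ball(1) ball(1)]
        C Fne near'[unfolded assms(21)] d(1) \<theta>0(1) d(2)
      have len: "norm (x (Suc k) - x k) \<le> (1 + \<theta> k) * c1 * s k"
        using lmm_ip_step_length[OF facts] by (simp add: s_def assms(8,21))
      also have "\<dots> \<le> M * s k"
        unfolding M_def using \<theta>0 c1 s0 by (intro mult_right_mono) auto
      finally show "norm (x (Suc k) - x k) \<le> M * s k" .
      show contr: "s (Suc k) \<le> (c1 * \<theta> k + K * s k) * s k"
        using lmm_ip_step_contraction[OF facts]
        by (simp add: s_def K_def A_def assms(8,21,22))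
      have "c1 * \<theta> k + K * s k \<le> \<eta>"
        unfolding \<eta> using \<theta>0 c1 K0 s_le[of k] near \<rho>\<sigma> by (intro add_mono mult_left_mono) auto
      then have "(c1 * \<theta> k + K * s k) * s k \<le> \<eta> * s k" by (rule mult_right_mono[OF _ s0])
      then show "s (Suc k) \<le> \<eta> * s k" using contr by linarith
    qed

    (* r is the radius for which the bound r + M r / (1 - eta) on the initial potential equals rho. *)
    have potential: "dist (x k) xstar + M / (1 - \<eta>) * s k \<le> \<rho>" for k
    proof (induction k)
      case 0
      have "dist (x 0) xstar \<le> r" using x0 by (simp add: dist_commute)
      moreover from this have "M / (1 - \<eta>) * s 0 \<le> M / (1 - \<eta>) * r"
        using s_le[of 0] M0 \<eta>1 by (intro mult_left_mono) auto
      moreover have "r + M / (1 - \<eta>) * r = \<rho>"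
      proof -
        have "r + M / (1 - \<eta>) * r = (1 - \<eta> + M) / (1 - \<eta>) * r"
          using \<eta>1 by (simp add: field_simps)
        also have "\<dots> = (1 - \<eta> + M) / (1 - \<eta>) * (\<rho> * ((1 - \<eta>) / (1 - \<eta> + M)))"
          by (simp add: r_def \<rho>_def M_def)
        also have "\<dots> = \<rho>" using \<eta>1 M0 by simp
        finally show ?thesis .
      qed
      ultimately show ?case by linarith
    next
      case (Suc k)
      have "0 \<le> M / (1 - \<eta>) * s k" using M0 \<eta>1 s0 by simp
      then have "dist (x k) xstar \<le> \<rho>" using Suc by linarith
      from step[OF this] show ?case
        using potential_decreases[of "x (Suc k)" "x k" M "s k" "s (Suc k)" \<eta> xstar] M0 \<eta>1 Suc
        by (simp add: dist_norm)
    qed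
    have near: "dist (x k) xstar \<le> \<rho>" for k
    proof -
      have "0 \<le> M / (1 - \<eta>) * s k" using M0 \<eta>1 s0 by simp
      then show ?thesis using potential[of k] by linarith
    qed
    show ?thesis
    proof (rule rate_from_distance_contraction[OF closed \<open>Cstar \<noteq> {}\<close>,
          where M = M and \<eta> = \<eta> and c = c1 and K = K and \<alpha> = \<alpha>])
      show "x k \<notin> Cstar" for k using Fne assms(8) by simp
      show "0 \<le> \<theta> k" "\<theta> k \<le> \<alpha>" for k using \<theta>[rule_format, of k] by auto
      show "M * (c1 * \<alpha>) + c1 * \<alpha> < 1" using small by (simp add: M_def)
    qed (use step[OF near] \<eta>0 \<eta>1 M0 c1 K0 in \<open>auto simp: s_def\<close>)
  qed
  then show ?thesis using \<alpha>0 \<alpha>1 by blast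
qed

end
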